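(* Let $G=(V,E)$ be a connected bipartite graph of order $n=r+s\ge 4$ with stable sets $U$ and $W$, $V=U\cup W$, where $|U|=r$, $|W|=s$ and $3\le r<s$. Then $\lambda(\overline{G})=\lambda(G)+1$ if and only if the following three conditions hold: (i) $W$ contains no pair of twins (in $G$); (ii) there exists a vertex $w\in W$ such that $N(w)=U$; (iii) for every vertex $u\in U$, the graph $G-u$ has at least two pairs of twins in $W$.
   Context: All graphs are simple and finite. $N(x)$ denotes the open neighborhood of $x$. A set $S\subseteq V$ is distinguishing if $N(x)\cap S\neq N(y)\cap S$ for all distinct $x,y\in V\setminus S$; dominating if every vertex not in $S$ has a neighbor in $S$; a locating-dominating set is a set that is both distinguishing and dominating. $\lambda(G)$ is the minimum cardinality of a locating-dominating set of $G$. $\overline{G}$ is the complement of $G$. Two distinct vertices $x,y$ of a graph are twins if $N(x)=N(y)$ or $N(x)\cup\{x\}=N(y)\cup\{y\}$ (neighborhoods taken in that graph). $G-u$ is the graph obtained by deleting vertex $u$. *)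

theory Defs
  imports "Graph_Theory.Graph_Theory"
begin

text \<open>
  A finite simple graph is a digraph satisfying the locale predicate \<open>graph\<close>
  (finite, loop-free, without parallel arcs, symmetric), each undirected edge being
  represented by its two opposite arcs.
\<close>

definition nbhd :: "('a, 'b) pre_digraph \<Rightarrow> 'a \<Rightarrow> 'a set" where
  "nbhd G x = {y. x \<rightarrow>\<^bsub>G\<^esub> y}"

definition distinguishing :: "('a, 'b) pre_digraph \<Rightarrow> 'a set \<Rightarrow> bool" where
  "distinguishing G S \<longleftrightarrow> S \<subseteq> verts G \<and>
     (\<forall>x \<in> verts G - S. \<forall>y \<in> verts G - S. x \<noteq> y \<longrightarrow> nbhd G x \<inter> S \<noteq> nbhd G y \<inter> S)"

definition dominating :: "('a, 'b) pre_digraph \<Rightarrow> 'a set \<Rightarrow> bool" where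
  "dominating G S \<longleftrightarrow> S \<subseteq> verts G \<and> (\<forall>x \<in> verts G - S. nbhd G x \<inter> S \<noteq> {})"

definition locating_dominating :: "('a, 'b) pre_digraph \<Rightarrow> 'a set \<Rightarrow> bool" where
  "locating_dominating G S \<longleftrightarrow> distinguishing G S \<and> dominating G S"

definition ld_number :: "('a, 'b) pre_digraph \<Rightarrow> nat" where
  "ld_number G = Min (card ` {S. locating_dominating G S})"

definition complement :: "('a, 'b) pre_digraph \<Rightarrow> 'a pair_pre_digraph" where
  "complement G =
     \<lparr> pverts = verts G,
       parcs = {(x, y). x \<in> verts G \<and> y \<in> verts G \<and> x \<noteq> y \<and> \<not> x \<rightarrow>\<^bsub>G\<^esub> y} \<rparr>"

definition twins :: "('a, 'b) pre_digraph \<Rightarrow> 'a \<Rightarrow> 'a \<Rightarrow> bool" where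
  "twins G x y \<longleftrightarrow> x \<in> verts G \<and> y \<in> verts G \<and> x \<noteq> y \<and>
     (nbhd G x = nbhd G y \<or> nbhd G x \<union> {x} = nbhd G y \<union> {y})"

definition twin_pairs :: "('a, 'b) pre_digraph \<Rightarrow> 'a set \<Rightarrow> 'a set set" where
  "twin_pairs G W = {{x, y} | x y. x \<in> W \<and> y \<in> W \<and> twins G x y}"

definition stable_set :: "('a, 'b) pre_digraph \<Rightarrow> 'a set \<Rightarrow> bool" where
  "stable_set G S \<longleftrightarrow> S \<subseteq> verts G \<and> (\<forall>x \<in> S. \<forall>y \<in> S. \<not> x \<rightarrow>\<^bsub>G\<^esub> y)"

definition bipartition :: "('a, 'b) pre_digraph \<Rightarrow> 'a set \<Rightarrow> 'a set \<Rightarrow> bool" where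
  "bipartition G U W \<longleftrightarrow>
     verts G = U \<union> W \<and> U \<inter> W = {} \<and> stable_set G U \<and> stable_set G W"

end

theory Submission
  imports Defs
begin

text \<open>
  A set \<open>S\<close> distinguishes \<open>G\<close> iff it distinguishes the complement, and it then dominates the
  complement iff no vertex outside \<open>S\<close> is adjacent to all of \<open>S\<close>. At most one vertex
  can be, and adding it to \<open>S\<close> repairs this, so the complement needs at most one vertex more.

  If the complement needs one more vertex, some \<open>x\<close> outside a minimum locating-dominating set
  \<open>S\<close> of \<open>G\<close> is adjacent to all of \<open>S\<close>; hence \<open>S\<close> lies on one side of the bipartition, and being
  dominating it is a whole side. Were \<open>G - u\<close> to have at most one twin pair on the other side,
  exchanging \<open>u\<close> for the member of that pair adjacent to \<open>u\<close> (or for \<open>x\<close>) would give a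
  locating-dominating set of the complement of the same size.

  The remaining ingredient is a count on the family \<open>F\<close> of neighbourhoods of one side. Deleting
  \<open>u\<close> from all members of \<open>F\<close> lowers its size by exactly the number of twin pairs created, and
  a pair differing only in \<open>v\<close> survives the deletion of any \<open>u \<noteq> v\<close>. So if each label in \<open>L\<close>
  occurs on two such pairs, deleting \<open>L\<close> lowers the size by at least \<open>card L + 1\<close>: two for the
  first label, one for each later one. This shows that trading the set \<open>L\<close> of vertices of \<open>U\<close> for
  vertices of \<open>W\<close> costs at least one vertex, and that \<open>W\<close> cannot be the minimum set when
  \<open>card U < card W\<close>.
\<close>

subsection \<open>Deleting labels from a family of sets\<close>

text \<open>With the members of \<open>F\<close> seen as vertices of a hypercube, these are the
  edges in direction \<open>u\<close> inside \<open>F\<close>, each represented by its endpoint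
  avoiding \<open>u\<close>.\<close>

definition label_edges :: "'a set set \<Rightarrow> 'a \<Rightarrow> 'a set set" where
  "label_edges F u = {X \<in> F. u \<notin> X \<and> insert u X \<in> F}"

text \<open>Deleting \<open>u\<close> is injective on the members containing \<open>u\<close> and
  fixes those avoiding it; the two images overlap exactly in the label edges, so inclusion-exclusion
  gives the count.\<close>

lemma card_delete_label:
  assumes "finite F"
  shows "card F = card ((\<lambda>X. X - {u}) ` F) + card (label_edges F u)"
proof -
  define A where "A = {X \<in> F. u \<notin> X}"
  define B where "B = {X \<in> F. u \<in> X}"
  have fin: "finite A" "finite B" using assms by (auto simp: A_def B_def)
  have F: "F = A \<union> B" "A \<inter> B = {}" by (auto simp: A_def B_def)
  have "inj_on (\<lambda>X. X - {u}) B" by (rule inj_onI) (auto simp: B_def)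
  then have cB: "card ((\<lambda>X. X - {u}) ` B) = card B" by (rule card_image)
  have "(\<lambda>X. X - {u}) ` A = A" by (force simp: A_def)
  then have img: "(\<lambda>X. X - {u}) ` F = A \<union> (\<lambda>X. X - {u}) ` B"
    by (simp add: F(1) image_Un)
  have edges: "label_edges F u = A \<inter> (\<lambda>X. X - {u}) ` B"
  proof
    show "label_edges F u \<subseteq> A \<inter> (\<lambda>X. X - {u}) ` B"
    proof
      fix X assume "X \<in> label_edges F u"
      then have X: "X \<in> F" "u \<notin> X" "insert u X \<in> F" by (auto simp: label_edges_def)
      then have "X = insert u X - {u}" "insert u X \<in> B" by (auto simp: B_def)
      then show "X \<in> A \<inter> (\<lambda>X. X - {u}) ` B" using X by (auto simp: A_def)
    qed
    show "A \<inter> (\<lambda>X. X - {u}) ` B \<subseteq> label_edges F u"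
      by (auto simp: A_def B_def label_edges_def insert_absorb)
  qed
  show ?thesis
    using card_Un_Int[OF fin(1) finite_imageI[OF fin(2), of "\<lambda>X. X - {u}"]]
      card_Un_disjoint[OF fin F(2)] by (simp add: img edges cB flip: F(1))
qed

lemma label_edges_delete:
  assumes "X \<in> label_edges F v" "u \<noteq> v"
  shows "X - {u} \<in> label_edges ((\<lambda>X. X - {u}) ` F) v"
proof -
  have "insert v (X - {u}) = insert v X - {u}" using assms(2) by auto
  with assms(1) show ?thesis by (auto simp: label_edges_def)
qed

lemma card_delete_labels:
  assumes "finite L" "finite F" "\<And>u. u \<in> L \<Longrightarrow> label_edges F u \<noteq> {}"
  shows "card ((\<lambda>X. X - L) ` F) + card L \<le> card F"
  using assms
\<comment> \<open>\<open>F\<close> stays arbitrary because the induction hypothesis is applied to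
  the family with \<open>u\<close> already deleted.\<close>
proof (induction L arbitrary: F rule: finite_induct)
  case empty
  then show ?case by simp
next
  case (insert u L)
  let ?F = "(\<lambda>X. X - {u}) ` F"
  have "label_edges ?F v \<noteq> {}" if "v \<in> L" for v
    using insert.prems(2)[of v] insert.hyps(2) label_edges_delete[of _ F v u] that by blast
  then have "card ((\<lambda>X. X - L) ` ?F) + card L \<le> card ?F"
    using insert.prems(1) by (intro insert.IH) auto
  moreover have "(\<lambda>X. X - L) ` ?F = (\<lambda>X. X - insert u L) ` F"
    unfolding image_image Diff_insert2[of _ u L] ..
  moreover have "card (label_edges F u) > 0"
    using insert.prems by (auto simp: card_gt_0_iff label_edges_def)
  ultimately show ?case
    using card_delete_label[OF insert.prems(1), of u] insert.hyps by simp
qed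

text \<open>Label edges in direction \<open>v\<close> may merge when \<open>u\<close> is deleted, so
  a count of two is available only for the label deleted first; the remaining labels are known only
  to keep one edge each.\<close>

lemma card_delete_labels_two:
  assumes "finite L" "L \<noteq> {}" "finite F" "\<And>u. u \<in> L \<Longrightarrow> 2 \<le> card (label_edges F u)"
  shows "card ((\<lambda>X. X - L) ` F) + card L + 1 \<le> card F"
proof -
  obtain u where u: "u \<in> L" using assms(2) by blast
  let ?F = "(\<lambda>X. X - {u}) ` F"
  have "label_edges ?F v \<noteq> {}" if "v \<in> L - {u}" for v
  proof -
    have "label_edges F v \<noteq> {}" using assms(4)[of v] that by auto
    then show ?thesis using label_edges_delete[of _ F v u] that by blast
  qed
  then have "card ((\<lambda>X. X - (L - {u})) ` ?F) + card (L - {u}) \<le> card ?F"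
    using assms by (intro card_delete_labels) auto
  moreover have "(\<lambda>X. X - (L - {u})) ` ?F = (\<lambda>X. X - L) ` F"
  proof -
    have "X - {u} - (L - {u}) = X - L" for X using u by auto
    then show ?thesis by (simp add: image_image)
  qed
  moreover have "card L = Suc (card (L - {u}))" using card_Suc_Diff1[OF assms(1) u] by (rule sym)
  ultimately show ?thesis
    using card_delete_label[OF assms(3), of u] assms(4)[OF u] by simp
qed

subsection \<open>Locating-dominating sets of a graph and of its complement\<close>

lemma finite_locating_dominating:
  assumes "finite (verts G)"
  shows "finite {S. locating_dominating G S}"
  by (rule finite_subset[of _ "Pow (verts G)"])
    (use assms in \<open>auto simp: locating_dominating_def dominating_def\<close>)

lemma ld_number_le:
  assumes "finite (verts G)" "locating_dominating G S"
  shows "ld_number G \<le> card S"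
  using finite_locating_dominating[OF assms(1)] assms(2)
  by (auto simp: ld_number_def intro!: Min_le)

lemma ld_number_attained:
  assumes "finite (verts G)"
  obtains S where "locating_dominating G S" "card S = ld_number G"
proof -
  have "locating_dominating G (verts G)"
    by (auto simp: locating_dominating_def dominating_def distinguishing_def)
  then have "Min (card ` {S. locating_dominating G S}) \<in> card ` {S. locating_dominating G S}"
    using finite_locating_dominating[OF assms] by (intro Min_in) auto
  then show ?thesis using that by (auto simp: ld_number_def)
qed

lemma pverts_complement [simp]: "pverts (complement G) = verts G"
  by (simp add: complement_def)

lemma nbhd_complement:
  assumes "x \<in> verts G"
  shows "nbhd (with_proj (complement G)) x = verts G - {x} - nbhd G x"
  using assms by (auto simp: nbhd_def complement_def)

lemma nbhd_del_vert:
  assumes "x \<noteq> u"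
  shows "nbhd (pre_digraph.del_vert G u) x = nbhd G x - {u}"
  using assms by (force simp: nbhd_def arcs_ends_def arc_to_ends_def pre_digraph.del_vert_simps)

text \<open>For \<open>x\<close> outside \<open>S\<close>, the trace of its neighbourhood on
  \<open>S\<close> becomes \<open>S - nbhd G x\<close>. Complementing inside \<open>S\<close> keeps
  distinct traces distinct, and the new trace is empty exactly when \<open>x\<close> is adjacent to
  all of \<open>S\<close>.\<close>

lemma locating_dominating_complement_iff:
  "locating_dominating (with_proj (complement G)) S \<longleftrightarrow>
     distinguishing G S \<and> (\<forall>x \<in> verts G - S. \<not> S \<subseteq> nbhd G x)"
proof (cases "S \<subseteq> verts G")
  case True
  have *: "nbhd (with_proj (complement G)) x \<inter> S = S - nbhd G x" if "x \<in> verts G - S" for x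
    using that True by (auto simp: nbhd_complement)
  have eq: "S - nbhd G x = S - nbhd G y \<longleftrightarrow> nbhd G x \<inter> S = nbhd G y \<inter> S" for x y by blast
  have "distinguishing (with_proj (complement G)) S \<longleftrightarrow> distinguishing G S"
    unfolding distinguishing_def with_proj_simps pverts_complement
    by (intro arg_cong2[of _ _ _ _ "(\<and>)"] ball_cong refl) (simp add: * eq)
  moreover have "dominating (with_proj (complement G)) S \<longleftrightarrow>
      (\<forall>x \<in> verts G - S. \<not> S \<subseteq> nbhd G x)"
    using True * by (auto simp: dominating_def)
  ultimately show ?thesis by (simp add: locating_dominating_def)
next
  case False
  then show ?thesis
    by (auto simp: locating_dominating_def distinguishing_def)
qed

lemma ld_number_complement_le:
  assumes "finite (verts G)"
  shows "ld_number (with_proj (complement G)) \<le> ld_number G + 1"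
proof -
  have fin: "finite (verts (with_proj (complement G)))" using assms by simp
  obtain S where S: "locating_dominating G S" "card S = ld_number G"
    using ld_number_attained[OF assms] by blast
  have dist: "distinguishing G S" using S(1) by (simp add: locating_dominating_def)
  show ?thesis
  proof (cases "\<exists>x \<in> verts G - S. S \<subseteq> nbhd G x")
    case False
    then have "locating_dominating (with_proj (complement G)) S"
      using dist by (simp add: locating_dominating_complement_iff)
    from ld_number_le[OF fin this] S(2) show ?thesis by simp
  next
    case True
    then obtain x where x: "x \<in> verts G - S" "S \<subseteq> nbhd G x" by blast
    have "distinguishing G (insert x S)"
      using dist x(1) unfolding distinguishing_def by blast
    \<comment> \<open>Such a \<open>y\<close> would have all of \<open>S\<close> as its trace, just
      like \<open>x\<close>, but \<open>S\<close> separates the two.\<close>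
    moreover have "\<not> insert x S \<subseteq> nbhd G y" if y: "y \<in> verts G - insert x S" for y
    proof
      assume "insert x S \<subseteq> nbhd G y"
      then have "nbhd G x \<inter> S = nbhd G y \<inter> S" using x(2) by blast
      then show False using dist x(1) y unfolding distinguishing_def by blast
    qed
    ultimately have "locating_dominating (with_proj (complement G)) (insert x S)"
      by (simp add: locating_dominating_complement_iff)
    from ld_number_le[OF fin this] S(2) show ?thesis
      using card_insert_le_m1[of "card S + 1" S x] by simp
  qed
qed

text \<open>Symmetry of the arcs turns connectedness into directed reachability, and the first arc
  of a walk from \<open>x\<close> to \<open>y\<close> supplies a neighbour.\<close>

lemma connected_nbhd_nonempty:
  assumes "graph G" "connected G" "x \<in> verts G" "y \<in> verts G" "x \<noteq> y"
  shows "nbhd G x \<noteq> {}"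
proof -
  interpret graph G by fact
  have "strongly_connected G"
    using assms(2) sym_arcs by (intro symmetric_connected_imp_strongly_connected)
  then have "x \<rightarrow>\<^sup>*\<^bsub>G\<^esub> y" using assms(3,4) by (simp add: strongly_connected_def)
  then show ?thesis
    using assms(5) by (cases rule: converse_reachable_cases) (auto simp: nbhd_def)
qed

subsection \<open>Bipartite graphs\<close>

locale bipartite_graph = graph G for G :: "('a, 'b) pre_digraph" +
  fixes U W :: "'a set"
  assumes bipartition: "bipartition G U W"
begin

text \<open>The two sides play symmetric roles; through this, each fact about one side is reused for
  the other.\<close>

lemma bipartite_graph_swap: "bipartite_graph G W U"
  using bipartition
  by unfold_locales (auto simp: bipartition_def)

lemma verts_eq: "verts G = U \<union> W" and sides_disjoint: "U \<inter> W = {}"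
  using bipartition by (auto simp: bipartition_def)

lemma finite_sides: "finite U" "finite W"
  using finite_verts by (auto simp: verts_eq)

lemma nbhd_subset_verts: "nbhd G x \<subseteq> verts G"
  by (auto simp: nbhd_def)

lemma nbhd_W: "x \<in> W \<Longrightarrow> nbhd G x \<subseteq> U"
  using bipartition nbhd_subset_verts[of x]
  by (auto simp: bipartition_def stable_set_def nbhd_def)

lemma nbhd_U: "x \<in> U \<Longrightarrow> nbhd G x \<subseteq> W"
  using bipartite_graph.nbhd_W[OF bipartite_graph_swap] .

lemma nbhd_sym: "y \<in> nbhd G x \<longleftrightarrow> x \<in> nbhd G y"
  using sym_arcs by (auto simp: nbhd_def symmetric_def dest: symD)

section \<open>Twins in \<open>W\<close> as coincidences of neighbourhoods\<close>

lemma twins_W_iff: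
  assumes "x \<in> W" "y \<in> W"
  shows "twins G x y \<longleftrightarrow> x \<noteq> y \<and> nbhd G x = nbhd G y"
proof -
  \<comment> \<open>This rules out equal closed neighbourhoods, which would make \<open>x\<close> a
    neighbour of \<open>y\<close>.\<close>
  have "x \<notin> nbhd G y" using assms nbhd_W sides_disjoint by blast
  then show ?thesis using assms by (auto simp: twins_def verts_eq)
qed

lemma twins_del_vert_W_iff:
  assumes "u \<in> U" "x \<in> W" "y \<in> W"
  shows "twins (pre_digraph.del_vert G u) x y \<longleftrightarrow>
    x \<noteq> y \<and> nbhd G x - {u} = nbhd G y - {u}"
proof -
  have "x \<noteq> u" "y \<noteq> u" "x \<notin> nbhd G y" using assms nbhd_W sides_disjoint by blast+
  then show ?thesis
    using assms by (auto simp: twins_def verts_eq nbhd_del_vert pre_digraph.del_vert_simps)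
qed

lemma twin_pairs_W_empty_iff: "twin_pairs G W = {} \<longleftrightarrow> inj_on (nbhd G) W"
  unfolding twin_pairs_def inj_on_def by (auto simp: twins_W_iff)

lemma twin_pairs_del_vert:
  assumes "u \<in> U"
  shows "twin_pairs (pre_digraph.del_vert G u) W =
    {{x, y} | x y. x \<in> W \<and> y \<in> W \<and> x \<noteq> y \<and> nbhd G x - {u} = nbhd G y - {u}}"
  unfolding twin_pairs_def using twins_del_vert_W_iff[OF assms] by blast

lemma distinguishing_U_iff: "distinguishing G U \<longleftrightarrow> inj_on (nbhd G) W"
proof -
  have "verts G - U = W" using verts_eq sides_disjoint by blast
  moreover have "nbhd G x \<inter> U = nbhd G x" if "x \<in> W" for x using nbhd_W[OF that] by blast
  ultimately show ?thesis by (auto simp: distinguishing_def inj_on_def verts_eq)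
qed

text \<open>The neighbourhoods of a twin pair created by deleting \<open>u\<close> are some
  \<open>X\<close> and \<open>insert u X\<close>. As neighbourhoods in \<open>W\<close> are
  distinct, the fibre \<open>pair_of X\<close> of the deletion map is just that pair, so each pair
  comes from a label edge.\<close>

lemma card_twin_pairs_le_label_edges:
  assumes "inj_on (nbhd G) W" "u \<in> U"
  shows "card (twin_pairs (pre_digraph.del_vert G u) W) \<le> card (label_edges (nbhd G ` W) u)"
proof -
  define pair_of where "pair_of X = {z \<in> W. nbhd G z - {u} = X}" for X
  have "twin_pairs (pre_digraph.del_vert G u) W \<subseteq> pair_of ` label_edges (nbhd G ` W) u"
  proof
    fix P assume "P \<in> twin_pairs (pre_digraph.del_vert G u) W"
    then obtain x y where P: "P = {x, y}" and xy: "x \<in> W" "y \<in> W" "x \<noteq> y"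
      and eq: "nbhd G x - {u} = nbhd G y - {u}"
      by (auto simp: twin_pairs_del_vert[OF assms(2)])
    have ne: "nbhd G x \<noteq> nbhd G y" using assms(1) xy by (auto dest: inj_onD)
    define X where "X = nbhd G x - {u}"
    have cases: "(nbhd G x = X \<and> nbhd G y = insert u X) \<or> (nbhd G y = X \<and> nbhd G x = insert u X)"
      using eq ne unfolding X_def by blast
    then have "X \<in> nbhd G ` W" "insert u X \<in> nbhd G ` W" using xy by (metis imageI)+
    then have "X \<in> label_edges (nbhd G ` W) u" by (auto simp: label_edges_def X_def)
    moreover have "pair_of X = {x, y}"
    proof
      show "{x, y} \<subseteq> pair_of X" using xy eq by (auto simp: pair_of_def X_def)
      show "pair_of X \<subseteq> {x, y}"
      proof
        fix z assume z: "z \<in> pair_of X"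
        then have "nbhd G z = X \<or> nbhd G z = insert u X" by (auto simp: pair_of_def)
        then have "nbhd G z = nbhd G x \<or> nbhd G z = nbhd G y" using cases by auto
        then show "z \<in> {x, y}"
          using z assms(1) xy by (auto simp: pair_of_def dest: inj_onD)
      qed
    qed
    ultimately show "P \<in> pair_of ` label_edges (nbhd G ` W) u" using P by blast
  qed
  moreover have "finite (label_edges (nbhd G ` W) u)"
    using finite_sides by (simp add: label_edges_def)
  ultimately show ?thesis by (meson card_image_le card_mono finite_imageI le_trans)
qed

section \<open>Lower bound for locating-dominating sets of the complement\<close>

lemma card_less_locating_dominating_complement:
  assumes inj: "inj_on (nbhd G) W" and full: "\<exists>w \<in> W. nbhd G w = U"
    and two: "\<And>u. u \<in> U \<Longrightarrow> 2 \<le> card (twin_pairs (pre_digraph.del_vert G u) W)"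
    and ld: "locating_dominating (with_proj (complement G)) S"
  shows "card U < card S"
proof -
  have dist: "distinguishing G S" and dom: "\<And>x. x \<in> verts G - S \<Longrightarrow> \<not> S \<subseteq> nbhd G x"
    using ld by (auto simp: locating_dominating_complement_iff)
  have SV: "S \<subseteq> U \<union> W" using dist by (simp add: distinguishing_def verts_eq)
  then have finS: "finite S" using finite_sides by (meson finite_UnI finite_subset)
  show ?thesis
  proof (cases "U - S = {}")
    case True
    obtain w where w: "w \<in> W" "nbhd G w = U" using full by blast
    \<comment> \<open>The vertex \<open>w\<close> is adjacent to all of \<open>U\<close>, so in the
      complement \<open>U\<close> fails to dominate it.\<close>
    have "S \<noteq> U"
      using dom[of w] w sides_disjoint by (auto simp: verts_eq)
    with True have "U \<subset> S" by blast
    then show ?thesis using finS by (rule psubset_card_mono[rotated])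
  next
    case False
    \<comment> \<open>\<open>L\<close> collects the vertices of \<open>U\<close> that
      \<open>S\<close> gives up. The counts below yield
      \<open>card L + 1 \<le> card (W \<inter> S)\<close>, so \<open>S\<close> has to take more
      vertices from \<open>W\<close> than it saves in \<open>U\<close>.\<close>
    define L where "L = U - S"
    let ?F = "nbhd G ` W"
    have "card ((\<lambda>X. X - L) ` ?F) + card L + 1 \<le> card ?F"
    proof (rule card_delete_labels_two)
      fix u assume "u \<in> L"
      then have "u \<in> U" by (simp add: L_def)
      then show "2 \<le> card (label_edges ?F u)"
        using two card_twin_pairs_le_label_edges[OF inj] le_trans by blast
    qed (use finite_sides False in \<open>auto simp: L_def\<close>)
    \<comment> \<open>Vertices of \<open>W\<close> see \<open>S\<close> only inside
      \<open>U - L\<close>, so those left outside \<open>S\<close> must still have distinct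
      neighbourhoods once \<open>L\<close> is deleted.\<close>
    moreover have "card (W - S) \<le> card ((\<lambda>X. X - L) ` ?F)"
    proof -
      have "inj_on (\<lambda>w. nbhd G w - L) (W - S)"
      proof (rule inj_onI)
        fix x y assume xy: "x \<in> W - S" "y \<in> W - S" "nbhd G x - L = nbhd G y - L"
        have "nbhd G x \<inter> S = nbhd G x - L" "nbhd G y \<inter> S = nbhd G y - L"
          using xy nbhd_W[of x] nbhd_W[of y] by (auto simp: L_def)
        then show "x = y" using xy dist unfolding distinguishing_def verts_eq by blast
      qed
      then have "card (W - S) = card ((\<lambda>w. nbhd G w - L) ` (W - S))" by (simp add: card_image)
      also have "\<dots> \<le> card ((\<lambda>X. X - L) ` ?F)"
        using finite_sides by (intro card_mono) auto
      finally show ?thesis .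
    qed
    moreover have "card ?F = card W" using inj by (rule card_image)
    moreover have "card W = card (W - S) + card (W \<inter> S)"
      using card_Int_Diff[OF finite_sides(2), of S] by simp
    moreover have "card U = card L + card (U \<inter> S)"
      using card_Int_Diff[OF finite_sides(1), of S] by (simp add: L_def)
    moreover have "card S = card (U \<inter> S) + card (W \<inter> S)"
    proof -
      have "S = (U \<inter> S) \<union> (W \<inter> S)" using SV by blast
      then show ?thesis
        using card_Un_disjoint[of "U \<inter> S" "W \<inter> S"] finS sides_disjoint by auto
    qed
    ultimately show ?thesis by simp
  qed
qed

section \<open>Exchanging a vertex of \<open>U\<close> for a vertex of \<open>W\<close>\<close>

lemma exchange_vertex:
  assumes inj: "inj_on (nbhd G) W" and w: "w \<in> W" "nbhd G w = U" and u: "u \<in> U"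
    and few: "card (twin_pairs (pre_digraph.del_vert G u) W) < 2"
  obtains w' where "w' \<in> W" "u \<in> nbhd G w'" "inj_on (\<lambda>x. nbhd G x - {u}) (W - {w'})"
proof (cases "inj_on (\<lambda>x. nbhd G x - {u}) W")
  case True
  then show ?thesis using that[of w] w u by (auto intro: inj_on_subset)
next
  case False
  let ?T = "twin_pairs (pre_digraph.del_vert G u) W"
  obtain x y where xy: "x \<in> W" "y \<in> W" "x \<noteq> y" "nbhd G x - {u} = nbhd G y - {u}"
    using False by (auto simp: inj_on_def)
  then have xyT: "{x, y} \<in> ?T" by (auto simp: twin_pairs_del_vert[OF u])
  have "?T \<subseteq> Pow W" by (auto simp: twin_pairs_def)
  then have "finite ?T" using finite_sides by (meson finite_Pow_iff finite_subset)
  then have only: "P = {x, y}" if "P \<in> ?T" for P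
    using few xyT that card_le_Suc0_iff_eq[of ?T] by auto
  have "nbhd G x \<noteq> nbhd G y" using inj xy by (auto dest: inj_onD)
  then have "u \<in> nbhd G x \<or> u \<in> nbhd G y" using xy(4) by blast
  \<comment> \<open>Removing either member of the only pair restores injectivity; the one adjacent
    to \<open>u\<close> is chosen so that it can later identify \<open>u\<close>.\<close>
  then obtain w' where w': "w' \<in> {x, y}" "u \<in> nbhd G w'" by blast
  have "inj_on (\<lambda>x. nbhd G x - {u}) (W - {w'})"
  proof (rule inj_onI, rule ccontr)
    fix a b assume ab: "a \<in> W - {w'}" "b \<in> W - {w'}"
      "nbhd G a - {u} = nbhd G b - {u}" "a \<noteq> b"
    then have "{a, b} \<in> ?T" unfolding twin_pairs_del_vert[OF u] by blast
    then have "w' \<in> {a, b}" using only w'(1) by blast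
    then show False using ab by auto
  qed
  then show ?thesis using that[of w'] w' xy by auto
qed

text \<open>By contraposition: with fewer than two pairs, \<open>insert w' (U - {u})\<close> is
  locating-dominating in the complement and has only \<open>card U\<close> vertices.\<close>

lemma twin_pairs_if_complement_gt:
  assumes inj: "inj_on (nbhd G) W" and w: "w \<in> W" "nbhd G w = U" and u: "u \<in> U"
    and "2 \<le> card U" and gt: "card U < ld_number (with_proj (complement G))"
  shows "2 \<le> card (twin_pairs (pre_digraph.del_vert G u) W)"
proof (rule ccontr)
  assume "\<not> ?thesis"
  then obtain w' where w': "w' \<in> W" "u \<in> nbhd G w'"
    and inj': "inj_on (\<lambda>x. nbhd G x - {u}) (W - {w'})"
    using exchange_vertex[OF inj w u] by (metis not_less)
  define S where "S = insert w' (U - {u})"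
  have "w' \<notin> U" using w' sides_disjoint by blast
  have out: "verts G - S = insert u (W - {w'})"
    using verts_eq sides_disjoint w' u by (auto simp: S_def)
  \<comment> \<open>The trace \<open>{w'}\<close> separates \<open>u\<close> from all of
    \<open>W\<close>, whose vertices have no neighbour in \<open>W\<close>.\<close>
  have Nu: "nbhd G u \<inter> S = {w'}"
    using nbhd_U[OF u] sides_disjoint w'(2) nbhd_sym[of u w'] by (auto simp: S_def)
  have NW: "nbhd G x \<inter> S = nbhd G x - {u}" if "x \<in> W" for x
    using nbhd_W[OF that] \<open>w' \<notin> U\<close> by (auto simp: S_def)
  have w'_out: "w' \<notin> nbhd G x" if "x \<in> W" for x using nbhd_W[OF that] \<open>w' \<notin> U\<close> by blast
  have "distinguishing G S"
    unfolding distinguishing_def out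
  proof (intro conjI ballI impI)
    show "S \<subseteq> verts G" using w' by (auto simp: S_def verts_eq)
    fix x y assume xy: "x \<in> insert u (W - {w'})" "y \<in> insert u (W - {w'})" "x \<noteq> y"
    then consider "x \<in> W - {w'}" "y \<in> W - {w'}" | "x = u" "y \<in> W" | "x \<in> W" "y = u" by auto
    then show "nbhd G x \<inter> S \<noteq> nbhd G y \<inter> S"
    proof cases
      case 1
      then show ?thesis using inj' xy(3) NW by (auto dest: inj_onD)
    next
      case 2
      then show ?thesis using Nu w'_out[of y] by auto
    next
      case 3
      then show ?thesis using Nu w'_out[of x] by auto
    qed
  qed
  moreover have "\<not> S \<subseteq> nbhd G x" if "x \<in> verts G - S" for x
  proof (cases "x = u")
    case True
    \<comment> \<open>A second vertex of \<open>U\<close> remains in \<open>S\<close> and is not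
      adjacent to \<open>u\<close>.\<close>
    have "U - {u} \<noteq> {}"
    proof
      assume "U - {u} = {}"
      then have "card U \<le> card {u}" by (intro card_mono) auto
      then show False using assms(5) by simp
    qed
    then show ?thesis using nbhd_U[OF u] sides_disjoint True by (auto simp: S_def)
  next
    case False
    then show ?thesis using that out w'_out by (auto simp: S_def)
  qed
  ultimately have "locating_dominating (with_proj (complement G)) S"
    by (simp add: locating_dominating_complement_iff)
  then have "ld_number (with_proj (complement G)) \<le> card S"
    by (intro ld_number_le) simp_all
  also have "card S = card U"
    using card_Suc_Diff1[OF finite_sides(1) u] finite_sides \<open>w' \<notin> U\<close>
    by (simp add: S_def del: card_Diff_insert)
  finally show False using gt by simp
qed

section \<open>Minimum sets of \<open>G\<close> when the complement needs more vertices\<close>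

lemma dominating_subset_U:
  assumes "dominating G S" "S \<subseteq> U"
  shows "S = U"
proof (rule ccontr)
  assume "S \<noteq> U"
  then obtain u where "u \<in> U - S" using assms(2) by blast
  then have "nbhd G u \<inter> S \<noteq> {}" using assms(1) by (auto simp: dominating_def verts_eq)
  then show False using nbhd_U[of u] \<open>u \<in> U - S\<close> assms(2) sides_disjoint by blast
qed

text \<open>A minimum set \<open>S\<close> of \<open>G\<close> is too small for the complement, so
  some \<open>x\<close> is adjacent to all of it. Then \<open>S\<close> lies opposite
  \<open>x\<close>, domination makes it that whole side, and \<open>x\<close> becomes the vertex
  with full neighbourhood.\<close>

lemma minimum_locating_dominating_is_side:
  assumes "ld_number G < ld_number (with_proj (complement G))"
  shows "(ld_number G = card U \<and> inj_on (nbhd G) W \<and> (\<exists>w \<in> W. nbhd G w = U)) \<or>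
    (ld_number G = card W \<and> inj_on (nbhd G) U \<and> (\<exists>u \<in> U. nbhd G u = W))"
proof -
  interpret swap: bipartite_graph G W U by (rule bipartite_graph_swap)
  obtain S where S: "locating_dominating G S" "card S = ld_number G"
    using ld_number_attained[OF finite_verts] by blast
  then have dist: "distinguishing G S" and dom: "dominating G S"
    by (auto simp: locating_dominating_def)
  have "\<not> locating_dominating (with_proj (complement G)) S"
    using ld_number_le[of "with_proj (complement G)" S] S(2) assms
    by auto
  then obtain x where x: "x \<in> verts G" "S \<subseteq> nbhd G x"
    using dist by (auto simp: locating_dominating_complement_iff)
  show ?thesis
  proof (cases "x \<in> W")
    case True
    then have "S = U" using x nbhd_W[of x] dom dominating_subset_U by blast
    then show ?thesis
      using S(2) dist distinguishing_U_iff True x nbhd_W[OF True] by auto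
  next
    case False
    then have "x \<in> U" using x by (simp add: verts_eq)
    then have "S = W" using x nbhd_U[of x] dom swap.dominating_subset_U by blast
    then show ?thesis
      using S(2) dist swap.distinguishing_U_iff \<open>x \<in> U\<close> x nbhd_U[OF \<open>x \<in> U\<close>] by auto
  qed
qed

end

theorem theorem18:
  fixes G :: "('a, 'b) pre_digraph" and U W :: "'a set" and n r s :: nat
  assumes "graph G"
    and "connected G"
    and "bipartition G U W"
    and "card (verts G) = n" and "n = r + s" and "n \<ge> 4"
    and "card U = r" and "card W = s"
    and "3 \<le> r" and "r < s"
  shows "ld_number (with_proj (complement G)) = ld_number G + 1 \<longleftrightarrow>
      twin_pairs G W = {} \<and>
      (\<exists>w \<in> W. nbhd G w = U) \<and>
      (\<forall>u \<in> U. card (twin_pairs (pre_digraph.del_vert G u) W) \<ge> 2)"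
proof -
  interpret bipartite_graph G U W
    using assms(1,3) by (simp add: bipartite_graph_def bipartite_graph_axioms_def)
  interpret swap: bipartite_graph G W U by (rule bipartite_graph_swap)
  let ?C = "with_proj (complement G)"
  show ?thesis
  proof
    assume eq: "ld_number ?C = ld_number G + 1"
    \<comment> \<open>If \<open>W\<close> were a minimum set, the exchange argument with the sides
      swapped would give two label edges for every \<open>w\<close> in \<open>W\<close> in the
      family of neighbourhoods of \<open>U\<close>. Deleting all of \<open>W\<close> then needs more
      than \<open>card W\<close> members, but the family has only \<open>card U\<close>.\<close>
    have not_W: False
      if W: "ld_number G = card W" and inj: "inj_on (nbhd G) U" and u: "u \<in> U" "nbhd G u = W" for u
    proof -
      have "2 \<le> card (label_edges (nbhd G ` U) w)" if "w \<in> W" for w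
      proof -
        have "2 \<le> card (twin_pairs (pre_digraph.del_vert G w) U)"
          using eq W assms by (intro swap.twin_pairs_if_complement_gt[OF inj u that]) auto
        then show ?thesis
          using swap.card_twin_pairs_le_label_edges[OF inj that] by simp
      qed
      moreover have "W \<noteq> {}" using assms by auto
      ultimately have "card W + 1 \<le> card (nbhd G ` U)"
        using card_delete_labels_two[of W "nbhd G ` U"] finite_sides by (simp add: add_leD2)
      then show False using card_image[OF inj] assms by simp
    qed
    have "ld_number G < ld_number ?C" using eq by simp
    then have U: "ld_number G = card U" "inj_on (nbhd G) W" "\<exists>w \<in> W. nbhd G w = U"
      using minimum_locating_dominating_is_side not_W by blast+
    then obtain w where w: "w \<in> W" "nbhd G w = U" by blast
    have "2 \<le> card (twin_pairs (pre_digraph.del_vert G u) W)" if "u \<in> U" for u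
      using eq U(1) assms by (intro twin_pairs_if_complement_gt[OF U(2) w that]) auto
    then show "twin_pairs G W = {} \<and> (\<exists>w \<in> W. nbhd G w = U) \<and>
        (\<forall>u \<in> U. card (twin_pairs (pre_digraph.del_vert G u) W) \<ge> 2)"
      using U twin_pairs_W_empty_iff by blast
  next
    assume conds: "twin_pairs G W = {} \<and> (\<exists>w \<in> W. nbhd G w = U) \<and>
        (\<forall>u \<in> U. card (twin_pairs (pre_digraph.del_vert G u) W) \<ge> 2)"
    then have inj: "inj_on (nbhd G) W" by (simp add: twin_pairs_W_empty_iff)
    have "dominating G U"
      unfolding dominating_def
    proof (intro conjI ballI)
      show "U \<subseteq> verts G" by (simp add: verts_eq)
      fix x assume "x \<in> verts G - U"
      then have x: "x \<in> W" "x \<in> verts G" by (auto simp: verts_eq)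
      have "U \<noteq> {}" using assms by auto
      then obtain u where "u \<in> U" by blast
      then have "nbhd G x \<noteq> {}"
        using x sides_disjoint by (intro connected_nbhd_nonempty[OF assms(1,2), of x u])
          (auto simp: verts_eq)
      then show "nbhd G x \<inter> U \<noteq> {}" using nbhd_W[OF x(1)] by blast
    qed
    then have "locating_dominating G U"
      using inj by (simp add: locating_dominating_def distinguishing_U_iff)
    then have "ld_number G \<le> card U" by (intro ld_number_le) simp_all
    moreover obtain S where S: "locating_dominating ?C S" "card S = ld_number ?C"
      using ld_number_attained[of ?C] by auto
    then have "card U < ld_number ?C"
      using card_less_locating_dominating_complement[OF inj _ _ S(1)] conds by simp
    \<comment> \<open>The value is squeezed: \<open>ld_number G \<le> card U < ld_number ?C \<le>
      ld_number G + 1\<close>.\<close>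
    ultimately show "ld_number ?C = ld_number G + 1"
      using ld_number_complement_le[OF finite_verts] by simp
  qed
qed

end
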